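(* For every term $M$ and every value $V$: if $M \to_{\ell\cup\beta}^{*} V$, then $(\widetilde{M})~\lambda x\,x \to_{a\cup\beta}^{*} \Psi(V)$.
   Context: Fix a ring of scalars (elements $\alpha,\beta$). Terms, values and base terms are given by: $M,N,L ::= V \mid (M)~N \mid \alpha.M \mid M+N$ (terms); $U,V,W ::= 0 \mid B \mid \alpha.V \mid V+W$ (values); $B ::= x \mid \lambda x\,M$ (base terms). Terms are taken up to renaming of bound variables; $M[x:=N]$ is capture-avoiding substitution. Below $V$ is a value and $B$ a base term. Rewrite rules: $(\beta_n)$ $(\lambda x\,M)~N\to M[x:=N]$. $(A)$ $(M+N)~L\to (M)~L+(N)~L$; $(\alpha.M)~N\to\alpha.(M)~N$; $(0)~M\to 0$. $(\beta_v)$ $(\lambda x\,M)~B\to M[x:=B]$. $(A_l)$ $(M+N)~V\to(M)~V+(N)~V$; $(\alpha.M)~V\to\alpha.(M)~V$; $(0)~V\to 0$. $(A_r)$ $(B)~(M+N)\to(B)~M+(B)~N$; $(B)~(\alpha.M)\to\alpha.(B)~M$; $(B)~0\to 0$. (Asso) $M+(N+L)\to(M+N)+L$ and $(M+N)+L\to M+(N+L)$. (Com) $M+N\to N+M$. $(F)$ $\alpha.M+\beta.M\to(\alpha+\beta).M$; $\alpha.M+M\to(\alpha+1).M$; $M+M\to(1+1).M$; $\alpha.(\beta.M)\to(\alpha\beta).M$. $(S)$ $\alpha.(M+N)\to\alpha.M+\alpha.N$; $1.M\to M$; $0.M\to 0$; $\alpha.0\to 0$; $0+M\to M$. Context rules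 $(\xi)$: from $M\to M'$ infer $(M)~N\to(M')~N$, $M+N\to M'+N$, $N+M\to N+M'$, $\alpha.M\to\alpha.M'$. Context rule $(\xi_{lin})$: from $M\to M'$ infer $(V)~M\to(V)~M'$ for $V$ a value. Let $L=\mathrm{Asso}\cup\mathrm{Com}\cup F\cup S$. Define: $\to_a$ generated by $A\cup L$ closed under $\xi$; $\to_\ell$ generated by $A_l\cup A_r\cup L$ closed under $\xi,\xi_{lin}$; $\to_{\beta_v}$ generated by $\beta_v$ closed under $\xi,\xi_{lin}$; $\to_{\beta_n}$ generated by $\beta_n$ closed under $\xi$. For a relation $R$, $R^{=}$ is its symmetric closure and $R^{*}$ its reflexive-transitive closure. Set $\to_{\ell\cup\beta}:=\to_\ell\cup\to_{\beta_v}$ (language $\lambda_{lin}^{\to}$), $\to^{=}_{\ell\cup\beta}:=(\to_\ell)^{=}\cup\to_{\beta_v}$ ($\lambda_{lin}^{=}$), $\to_{a\cup\beta}:=\to_a\cup\to_{\beta_n}$ ($\lambda_{alg}^{\to}$), $\to^{=}_{a\cup\beta}:=(\to_a)^{=}\cup\to_{\beta_n}$ ($\lambda_{alg}^{=}$). Translation (with $f,g,h$ fresh variables): $\widetilde{x}=\lambda f\,(f)~x$; $\widetilde{0}=0$; $\widetilde{\lambda x\,M}=\lambda f\,(f)~\lambda x\,\widetilde{M}$; $\widetilde{(M)~N}=\lambda f\,(\widetilde M)~\lambda g\,(\widetilde N)~\lambda h\,((g)~h)~f$; $\widetilde{\alpha.M}=\lambda f\,(\alpha.\widetilde M)~f$;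 $\widetilde{M+N}=\lambda f\,(\widetilde M+\widetilde N)~f$. On values: $\Psi(x)=x$, $\Psi(0)=0$, $\Psi(\lambda x\,M)=\lambda x\,\widetilde M$, $\Psi(\alpha.V)=\alpha.\Psi(V)$, $\Psi(V+W)=\Psi(V)+\Psi(W)$. *)

theory Defs
  imports Main
begin

text \<open>
  Terms up to renaming of bound variables are represented by de Bruijn indices; an index
  pointing beyond all enclosing binders denotes a free variable, so open terms are included.
  The scalars range over a type of sort \<open>{ring, monoid_mult}\<close>: an arbitrary unital ring,
  not assumed commutative, the zero ring not excluded (as \<open>ring_1\<close> would do).
\<close>

datatype 's trm =
    Var nat
  | Lam "'s trm"
  | App "'s trm" "'s trm"
  | Zero
  | Scale 's "'s trm"
  | Plus "'s trm" "'s trm"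

inductive is_base :: "'s trm \<Rightarrow> bool" where
  "is_base (Var i)"
| "is_base (Lam M)"

inductive is_value :: "'s trm \<Rightarrow> bool" where
  "is_value Zero"
| "is_base B \<Longrightarrow> is_value B"
| "is_value V \<Longrightarrow> is_value (Scale a V)"
| "is_value V \<Longrightarrow> is_value W \<Longrightarrow> is_value (Plus V W)"

text \<open>\<open>lift k M\<close> makes room for a new variable with index \<open>k\<close>.\<close>

primrec lift :: "nat \<Rightarrow> 's trm \<Rightarrow> 's trm" where
  "lift k (Var i) = (if i < k then Var i else Var (Suc i))"
| "lift k (Lam M) = Lam (lift (Suc k) M)"
| "lift k (App M N) = App (lift k M) (lift k N)"
| "lift k Zero = Zero"
| "lift k (Scale a M) = Scale a (lift k M)"
| "lift k (Plus M N) = Plus (lift k M) (lift k N)"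

text \<open>\<open>subst M k N\<close> replaces index \<open>k\<close> in \<open>M\<close> by \<open>N\<close> and removes that index, so that
  the contractum of \<open>App (Lam M) N\<close> is \<open>subst M 0 N\<close>.\<close>

primrec subst :: "'s trm \<Rightarrow> nat \<Rightarrow> 's trm \<Rightarrow> 's trm" where
  "subst (Var i) k N = (if k < i then Var (i - 1) else if i = k then N else Var i)"
| "subst (Lam M) k N = Lam (subst M (Suc k) (lift 0 N))"
| "subst (App M M') k N = App (subst M k N) (subst M' k N)"
| "subst Zero k N = Zero"
| "subst (Scale a M) k N = Scale a (subst M k N)"
| "subst (Plus M M') k N = Plus (subst M k N) (subst M' k N)"

inductive rule_beta_n :: "'s trm \<Rightarrow> 's trm \<Rightarrow> bool" where
  "rule_beta_n (App (Lam M) N) (subst M 0 N)"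

inductive rule_beta_v :: "'s trm \<Rightarrow> 's trm \<Rightarrow> bool" where
  "is_base B \<Longrightarrow> rule_beta_v (App (Lam M) B) (subst M 0 B)"

inductive rule_A :: "'s trm \<Rightarrow> 's trm \<Rightarrow> bool" where
  "rule_A (App (Plus M N) L) (Plus (App M L) (App N L))"
| "rule_A (App (Scale a M) N) (Scale a (App M N))"
| "rule_A (App Zero M) Zero"

inductive rule_Al :: "'s trm \<Rightarrow> 's trm \<Rightarrow> bool" where
  "is_value V \<Longrightarrow> rule_Al (App (Plus M N) V) (Plus (App M V) (App N V))"
| "is_value V \<Longrightarrow> rule_Al (App (Scale a M) V) (Scale a (App M V))"
| "is_value V \<Longrightarrow> rule_Al (App Zero V) Zero"

inductive rule_Ar :: "'s trm \<Rightarrow> 's trm \<Rightarrow> bool" where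
  "is_base B \<Longrightarrow> rule_Ar (App B (Plus M N)) (Plus (App B M) (App B N))"
| "is_base B \<Longrightarrow> rule_Ar (App B (Scale a M)) (Scale a (App B M))"
| "is_base B \<Longrightarrow> rule_Ar (App B Zero) Zero"

inductive rule_Asso :: "'s trm \<Rightarrow> 's trm \<Rightarrow> bool" where
  "rule_Asso (Plus M (Plus N L)) (Plus (Plus M N) L)"
| "rule_Asso (Plus (Plus M N) L) (Plus M (Plus N L))"

inductive rule_Com :: "'s trm \<Rightarrow> 's trm \<Rightarrow> bool" where
  "rule_Com (Plus M N) (Plus N M)"

inductive rule_F :: "'s::{ring,monoid_mult} trm \<Rightarrow> 's trm \<Rightarrow> bool" where
  "rule_F (Plus (Scale a M) (Scale b M)) (Scale (a + b) M)"
| "rule_F (Plus (Scale a M) M) (Scale (a + 1) M)"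
| "rule_F (Plus M M) (Scale (1 + 1) M)"
| "rule_F (Scale a (Scale b M)) (Scale (a * b) M)"

inductive rule_S :: "'s::{ring,monoid_mult} trm \<Rightarrow> 's trm \<Rightarrow> bool" where
  "rule_S (Scale a (Plus M N)) (Plus (Scale a M) (Scale a N))"
| "rule_S (Scale 1 M) M"
| "rule_S (Scale 0 M) Zero"
| "rule_S (Scale a Zero) Zero"
| "rule_S (Plus Zero M) M"

definition rule_L :: "'s::{ring,monoid_mult} trm \<Rightarrow> 's trm \<Rightarrow> bool" where
  "rule_L = sup rule_Asso (sup rule_Com (sup rule_F rule_S))"

inductive xi_closure :: "('s trm \<Rightarrow> 's trm \<Rightarrow> bool) \<Rightarrow> 's trm \<Rightarrow> 's trm \<Rightarrow> bool"
  for R where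
  "R M M' \<Longrightarrow> xi_closure R M M'"
| "xi_closure R M M' \<Longrightarrow> xi_closure R (App M N) (App M' N)"
| "xi_closure R M M' \<Longrightarrow> xi_closure R (Plus M N) (Plus M' N)"
| "xi_closure R M M' \<Longrightarrow> xi_closure R (Plus N M) (Plus N M')"
| "xi_closure R M M' \<Longrightarrow> xi_closure R (Scale a M) (Scale a M')"

inductive xi_lin_closure :: "('s trm \<Rightarrow> 's trm \<Rightarrow> bool) \<Rightarrow> 's trm \<Rightarrow> 's trm \<Rightarrow> bool"
  for R where
  "R M M' \<Longrightarrow> xi_lin_closure R M M'"
| "xi_lin_closure R M M' \<Longrightarrow> xi_lin_closure R (App M N) (App M' N)"
| "xi_lin_closure R M M' \<Longrightarrow> xi_lin_closure R (Plus M N) (Plus M' N)"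
| "xi_lin_closure R M M' \<Longrightarrow> xi_lin_closure R (Plus N M) (Plus N M')"
| "xi_lin_closure R M M' \<Longrightarrow> xi_lin_closure R (Scale a M) (Scale a M')"
| "is_value V \<Longrightarrow> xi_lin_closure R M M' \<Longrightarrow> xi_lin_closure R (App V M) (App V M')"

definition red_a :: "'s::{ring,monoid_mult} trm \<Rightarrow> 's trm \<Rightarrow> bool" where
  "red_a = xi_closure (sup rule_A rule_L)"

definition red_l :: "'s::{ring,monoid_mult} trm \<Rightarrow> 's trm \<Rightarrow> bool" where
  "red_l = xi_lin_closure (sup rule_Al (sup rule_Ar rule_L))"

definition red_beta_n :: "'s trm \<Rightarrow> 's trm \<Rightarrow> bool" where
  "red_beta_n = xi_closure rule_beta_n"

definition red_beta_v :: "'s trm \<Rightarrow> 's trm \<Rightarrow> bool" where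
  "red_beta_v = xi_lin_closure rule_beta_v"

definition red_lin :: "'s::{ring,monoid_mult} trm \<Rightarrow> 's trm \<Rightarrow> bool" where
  "red_lin = sup red_l red_beta_v"

definition red_alg :: "'s::{ring,monoid_mult} trm \<Rightarrow> 's trm \<Rightarrow> bool" where
  "red_alg = sup red_a red_beta_n"

text \<open>
  In the translation, freshness of the variables \<open>f\<close>, \<open>g\<close>, \<open>h\<close> is expressed by lifting the
  subterms placed below their binders.  In the application clause the term
  \<open>\<lambda>h ((g) h) f\<close> sits below \<open>\<lambda>f\<close> and \<open>\<lambda>g\<close>, so that \<open>h\<close>, \<open>g\<close>, \<open>f\<close> have
  indices 0, 1, 2 in its body.
\<close>

primrec cps :: "'s trm \<Rightarrow> 's trm" where
  "cps (Var i) = Lam (App (Var 0) (Var (Suc i)))"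
| "cps Zero = Zero"
| "cps (Lam M) = Lam (App (Var 0) (lift 0 (Lam (cps M))))"
| "cps (App M N) =
     Lam (App (lift 0 (cps M))
       (Lam (App (lift 0 (lift 0 (cps N)))
         (Lam (App (App (Var 1) (Var 0)) (Var 2))))))"
| "cps (Scale a M) = Lam (App (Scale a (lift 0 (cps M))) (Var 0))"
| "cps (Plus M N) = Lam (App (Plus (lift 0 (cps M)) (lift 0 (cps N))) (Var 0))"

text \<open>\<open>Psi\<close> is meant for values only, in which no application occurs outside an abstraction.\<close>

primrec Psi :: "'s trm \<Rightarrow> 's trm" where
  "Psi (Var i) = Var i"
| "Psi Zero = Zero"
| "Psi (Lam M) = Lam (cps M)"
| "Psi (Scale a V) = Scale a (Psi V)"
| "Psi (Plus V W) = Plus (Psi V) (Psi W)"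
| "Psi (App M N) = undefined"

end

theory Submission
  imports Defs
begin

text \<open>
  The colon translation \<open>colon M K\<close> (in the style of Plotkin) is what remains of \<open>App (cps M) K\<close>
  after the administrative reductions.  It is homomorphic in sums and scalars, so the rules
  \<open>L\<close>, \<open>A\<^sub>l\<close>, \<open>A\<^sub>r\<close> on \<open>M\<close> become \<open>L\<close>-steps or identities on \<open>colon M K\<close>, and a \<open>\<beta>\<^sub>v\<close>-step becomes
  \<open>\<beta>\<^sub>n\<close>-steps followed by administrative ones.  Since the call-by-name side does not reduce below
  abstractions, \<open>colon (App V N) K\<close> for a value \<open>V\<close> has to expose \<open>N\<close> already: it distributes over
  the linear combination \<open>V\<close> and passes \<open>N\<close> one continuation for each base term of \<open>V\<close>.
\<close>

inductive_simps is_base_simps [simp]: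
  "is_base (Var i)" "is_base (Lam M)" "is_base (App M N)" "is_base Zero"
  "is_base (Scale a M)" "is_base (Plus M N)"

inductive_simps is_value_simps [simp]:
  "is_value (Var i)" "is_value (Lam M)" "is_value (App M N)" "is_value Zero"
  "is_value (Scale a M)" "is_value (Plus M N)"


section \<open>Lifting, substitution and the translation\<close>

lemma lift_lift:
  "i \<le> k \<Longrightarrow> lift (Suc k) (lift i M) = lift i (lift k M)"
  by (induction M arbitrary: i k) auto

lemma subst_lift [simp]:
  "subst (lift k M) k N = M"
  by (induction M arbitrary: k N) auto

lemma subst_lift_commute:
  "i \<le> k \<Longrightarrow> subst (lift i M) (Suc k) (lift i N) = lift i (subst M k N)"
  by (induction M arbitrary: i k N) (auto simp: lift_lift [symmetric])

lemma subst_lift_lift [simp]: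
  "subst (lift 0 (lift 0 M)) (Suc 0) (lift 0 N) = lift 0 M"
  by (simp add: subst_lift_commute)

lemma cps_lift:
  "cps (lift k M) = lift k (cps M)"
  by (induction M arbitrary: k) (auto simp: lift_lift)

lemma Psi_lift_base:
  "is_base B \<Longrightarrow> Psi (lift k B) = lift k (Psi B)"
  by (auto simp: cps_lift elim: is_base.cases)

lemma is_base_lift:
  "is_base B \<Longrightarrow> is_base (lift k B)"
  by (auto elim: is_base.cases)

lemma cps_base:
  "is_base B \<Longrightarrow> cps B = Lam (App (Var 0) (lift 0 (Psi B)))"
  by (auto elim: is_base.cases)

text \<open>A source variable occurs in \<open>cps M\<close> only as the argument of a continuation,
  exactly where \<open>cps B\<close> carries \<open>Psi B\<close>. Substituting \<open>Psi B\<close>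
  there thus rebuilds the translation of \<open>B\<close>.\<close>

lemma cps_subst:
  "is_base B \<Longrightarrow> cps (subst M k B) = subst (cps M) k (Psi B)"
proof (induction M arbitrary: k B)
  case (Var i)
  then show ?case by (auto simp: cps_base)
next
  case (Lam M)
  then show ?case
    by (simp add: is_base_lift Psi_lift_base subst_lift_commute lift_lift [symmetric])
qed (auto simp: subst_lift_commute)


section \<open>Call-by-name reduction\<close>

abbreviation alg_steps :: "'s::{ring,monoid_mult} trm \<Rightarrow> 's trm \<Rightarrow> bool"  (infix "\<rightarrow>\<^sub>a*" 50)
  where "M \<rightarrow>\<^sub>a* N \<equiv> red_alg\<^sup>*\<^sup>* M N"

lemma red_alg_A: "rule_A M N \<Longrightarrow> red_alg M N"
  and red_alg_L: "rule_L M N \<Longrightarrow> red_alg M N"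
  and red_alg_beta: "red_alg (App (Lam P) Q) (subst P 0 Q)"
  by (auto simp: red_alg_def red_a_def red_beta_n_def
      intro: xi_closure.intros(1) rule_beta_n.intros)

lemma red_alg_ctxt:
  assumes "red_alg M M'"
  shows "red_alg (App M N) (App M' N)" "red_alg (Plus M N) (Plus M' N)"
    "red_alg (Plus N M) (Plus N M')" "red_alg (Scale a M) (Scale a M')"
  using assms by (auto simp: red_alg_def red_a_def red_beta_n_def intro: xi_closure.intros)

lemma alg_steps_app: "M \<rightarrow>\<^sub>a* M' \<Longrightarrow> App M N \<rightarrow>\<^sub>a* App M' N"
  by (induction rule: rtranclp_induct) (auto intro: red_alg_ctxt rtranclp.rtrancl_into_rtrancl)

lemma alg_steps_scale: "M \<rightarrow>\<^sub>a* M' \<Longrightarrow> Scale a M \<rightarrow>\<^sub>a* Scale a M'"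
  by (induction rule: rtranclp_induct) (auto intro: red_alg_ctxt rtranclp.rtrancl_into_rtrancl)

lemma alg_steps_plus:
  assumes "M \<rightarrow>\<^sub>a* M'" "N \<rightarrow>\<^sub>a* N'"
  shows "Plus M N \<rightarrow>\<^sub>a* Plus M' N'"
proof -
  have "Plus M N \<rightarrow>\<^sub>a* Plus M' N" using assms(1)
    by (induction rule: rtranclp_induct) (auto intro: red_alg_ctxt rtranclp.rtrancl_into_rtrancl)
  also have "Plus M' N \<rightarrow>\<^sub>a* Plus M' N'" using assms(2)
    by (induction rule: rtranclp_induct) (auto intro: red_alg_ctxt rtranclp.rtrancl_into_rtrancl)
  finally show ?thesis .
qed


section \<open>Linear extension over values\<close>

primrec lin_ext :: "('s trm \<Rightarrow> 's trm) \<Rightarrow> 's trm \<Rightarrow> 's trm" where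
  "lin_ext \<phi> (Var i) = \<phi> (Var i)"
| "lin_ext \<phi> (Lam M) = \<phi> (Lam M)"
| "lin_ext \<phi> (App M N) = undefined"
| "lin_ext \<phi> Zero = Zero"
| "lin_ext \<phi> (Scale a M) = Scale a (lin_ext \<phi> M)"
| "lin_ext \<phi> (Plus M N) = Plus (lin_ext \<phi> M) (lin_ext \<phi> N)"

lemma lin_ext_base: "is_base B \<Longrightarrow> lin_ext \<phi> B = \<phi> B"
  by (auto elim: is_base.cases)

lemma lin_ext_Psi: "is_value V \<Longrightarrow> lin_ext Psi V = Psi V"
  by (induction V) auto

lemma lin_ext_steps:
  assumes "is_value V" "\<And>B. is_base B \<Longrightarrow> \<phi> B \<rightarrow>\<^sub>a* \<psi> B"
  shows "lin_ext \<phi> V \<rightarrow>\<^sub>a* lin_ext \<psi> V"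
  using assms(1) by (induction V) (auto simp: lin_ext_base intro: assms(2) alg_steps_scale alg_steps_plus)

text \<open>The rules in \<open>rule_L\<close> rewrite linear combinations of arbitrary terms, so a
  map commuting with \<open>Zero\<close>, \<open>Scale\<close> and \<open>Plus\<close> sends an
  instance to an instance of the same rule. It serves for both \<open>lin_ext\<close> and
  \<open>colon\<close>.\<close>

lemma rule_L_hom:
  assumes "rule_L M M'"
    and "h Zero = Zero" "\<And>a N. h (Scale a N) = Scale a (h N)"
    and "\<And>N L. h (Plus N L) = Plus (h N) (h L)"
  shows "rule_L (h M) (h M')"
  using assms(1) unfolding rule_L_def
  by (auto simp: assms(2-) rule_Asso.simps rule_Com.simps rule_F.simps rule_S.simps)

lemma rule_L_value: "rule_L M M' \<Longrightarrow> is_value M \<Longrightarrow> is_value M'"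
  by (auto simp: rule_L_def rule_Asso.simps rule_Com.simps rule_F.simps rule_S.simps)

text \<open>A single closure over all rules allows one induction on the context of a step.\<close>

lemma red_lin_imp_xi_lin_closure:
  assumes "red_lin M M'"
  shows "xi_lin_closure (sup rule_beta_v (sup rule_Al (sup rule_Ar rule_L))) M M'"
proof -
  have mono: "xi_lin_closure R M M'" if "xi_lin_closure Q M M'" "Q \<le> R"
    for Q R :: "'a trm \<Rightarrow> 'a trm \<Rightarrow> bool"
    using that by induction (auto intro: xi_lin_closure.intros)
  show ?thesis
    using assms unfolding red_lin_def red_l_def red_beta_v_def
    by (auto intro: mono)
qed

lemma value_step:
  assumes "xi_lin_closure (sup rule_beta_v (sup rule_Al (sup rule_Ar rule_L))) M M'"
    and "is_value M"
  shows "is_value M' \<and> lin_ext \<phi> M \<rightarrow>\<^sub>a* lin_ext \<phi> M'"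
  using assms
proof induction
  case (1 M M')
  \<comment> \<open>The other rules have an application on the left, which is never a value.\<close>
  then have "rule_L M M'"
    by (auto simp: rule_beta_v.simps rule_Al.simps rule_Ar.simps)
  then have "rule_L (lin_ext \<phi> M) (lin_ext \<phi> M')"
    by (rule rule_L_hom) auto
  with \<open>rule_L M M'\<close> 1 show ?case
    by (auto intro: rule_L_value red_alg_L)
qed (auto intro: alg_steps_scale alg_steps_plus)


section \<open>The colon translation\<close>

text \<open>The two continuations arising from \<open>cps (App M N)\<close>:
  \<open>fun_cont N K\<close> awaits the function, then \<open>arg_cont B K\<close> awaits the
  argument of the function \<open>B\<close>.\<close>

definition arg_cont :: "'s trm \<Rightarrow> 's trm \<Rightarrow> 's trm" where
  "arg_cont B K = Lam (App (App (lift 0 B) (Var 0)) (lift 0 K))"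

definition fun_cont :: "'s trm \<Rightarrow> 's trm \<Rightarrow> 's trm" where
  "fun_cont N K = Lam (App (lift 0 (cps N))
     (Lam (App (App (Var 1) (Var 0)) (lift 0 (lift 0 K)))))"

primrec colon :: "'s trm \<Rightarrow> 's trm \<Rightarrow> 's trm" where
  "colon (Var i) K = App K (Psi (Var i))"
| "colon (Lam M) K = App K (Psi (Lam M))"
| "colon Zero K = Zero"
| "colon (Scale a M) K = Scale a (colon M K)"
| "colon (Plus M N) K = Plus (colon M K) (colon N K)"
| "colon (App M N) K =
     (if is_value M then lin_ext (\<lambda>B. colon N (arg_cont (Psi B) K)) M
      else colon M (fun_cont N K))"

lemma colon_value: "is_value V \<Longrightarrow> colon V K = lin_ext (\<lambda>B. App K (Psi B)) V"
  by (induction V) auto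

lemma fun_cont_step: "red_alg (App (fun_cont N K) B) (App (cps N) (arg_cont B K))"
  using red_alg_beta [of _ B]
  by (metis (no_types, lifting) arg_cont_def fun_cont_def One_nat_def lessI less_irrefl_nat
      subst.simps(1-3) subst_lift subst_lift_lift zero_less_Suc not_less_zero)

text \<open>The sides differ only if \<open>M\<close> is a value; then one contraction of
  \<open>fun_cont N K\<close> at each base term starts evaluating \<open>N\<close>. The property of
  \<open>N\<close> is assumed because it is an induction hypothesis in \<open>cps_colon\<close>,
  whose proof uses this lemma.\<close>

lemma colon_app_steps:
  assumes "\<And>K. App (cps N) K \<rightarrow>\<^sub>a* colon N K"
  shows "colon M (fun_cont N K) \<rightarrow>\<^sub>a* colon (App M N) K"
proof (cases "is_value M")
  case True
  have "App (fun_cont N K) (Psi B) \<rightarrow>\<^sub>a* colon N (arg_cont (Psi B) K)" for B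
    by (rule converse_rtranclp_into_rtranclp [OF fun_cont_step assms])
  with True show ?thesis
    by (simp add: colon_value lin_ext_steps)
qed simp

lemma cps_colon: "App (cps M) K \<rightarrow>\<^sub>a* colon M K"
proof (induction M arbitrary: K)
  case (Var i)
  then show ?case using red_alg_beta [of "App (Var 0) (Var (Suc i))" K] by auto
next
  case (Lam M)
  then show ?case
    using red_alg_beta [of "App (Var 0) (lift 0 (Lam (cps M)))" K]
    by (auto simp del: lift.simps)
next
  case (App M N)
  have "red_alg (App (cps (App M N)) K) (App (cps M) (fun_cont N K))"
    using red_alg_beta [of "App (lift 0 (cps M)) (Lam (App (lift 0 (lift 0 (cps N)))
      (Lam (App (App (Var 1) (Var 0)) (Var 2)))))" K]
    by (simp add: fun_cont_def)
  also have "App (cps M) (fun_cont N K) \<rightarrow>\<^sub>a* colon M (fun_cont N K)" by (rule App.IH)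
  also have "\<dots> \<rightarrow>\<^sub>a* colon (App M N) K" by (rule colon_app_steps [OF App.IH(2)])
  finally show ?case .
next
  case Zero
  then show ?case by (auto intro: red_alg_A rule_A.intros)
next
  case (Scale a M)
  have "red_alg (App (cps (Scale a M)) K) (App (Scale a (cps M)) K)"
    using red_alg_beta [of "App (Scale a (lift 0 (cps M))) (Var 0)" K] by simp
  also have "App (Scale a (cps M)) K \<rightarrow>\<^sub>a* Scale a (App (cps M) K)"
    by (intro r_into_rtranclp red_alg_A rule_A.intros)
  also have "\<dots> \<rightarrow>\<^sub>a* colon (Scale a M) K" by (auto intro: Scale.IH alg_steps_scale)
  finally show ?case .
next
  case (Plus M N)
  have "red_alg (App (cps (Plus M N)) K) (App (Plus (cps M) (cps N)) K)"
    using red_alg_beta [of "App (Plus (lift 0 (cps M)) (lift 0 (cps N))) (Var 0)" K] by simp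
  also have "App (Plus (cps M) (cps N)) K \<rightarrow>\<^sub>a* Plus (App (cps M) K) (App (cps N) K)"
    by (intro r_into_rtranclp red_alg_A rule_A.intros)
  also have "\<dots> \<rightarrow>\<^sub>a* colon (Plus M N) K" by (auto intro: Plus.IH alg_steps_plus)
  finally show ?case .
qed

lemma colon_app: "colon M (fun_cont N K) \<rightarrow>\<^sub>a* colon (App M N) K"
  by (rule colon_app_steps [OF cps_colon])

lemma colon_beta_v:
  assumes "is_base B"
  shows "colon (App (Lam M) B) K \<rightarrow>\<^sub>a* colon (subst M 0 B) K"
proof -
  have "colon (App (Lam M) B) K = App (arg_cont (Lam (cps M)) K) (Psi B)"
    using assms by (auto simp: colon_value lin_ext_base is_value.intros(2))
  also have "red_alg \<dots> (App (App (Lam (cps M)) (Psi B)) K)"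
    using red_alg_beta [of "App (App (lift 0 (Lam (cps M))) (Var 0)) (lift 0 K)" "Psi B"]
    by (simp add: arg_cont_def del: lift.simps)
  \<comment> \<open>The source redex is now in function position, where it may be contracted;
    \<open>cps_subst\<close> identifies the contractum.\<close>
  also have "App (App (Lam (cps M)) (Psi B)) K \<rightarrow>\<^sub>a* App (cps (subst M 0 B)) K"
    using red_alg_ctxt(1) [OF red_alg_beta] by (auto simp: cps_subst assms)
  also have "\<dots> \<rightarrow>\<^sub>a* colon (subst M 0 B) K" by (rule cps_colon)
  finally show ?thesis .
qed

text \<open>The one mismatch is a sum with exactly one value summand: the sum is not a value, but
  that summand applied alone falls under the other clause of \<open>colon\<close>.
  \<open>colon_app\<close> bridges the gap.\<close>

lemma colon_Al: "rule_Al M M' \<Longrightarrow> colon M K \<rightarrow>\<^sub>a* colon M' K"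
proof (induction rule: rule_Al.induct)
  case (1 V M N)
  have "Plus (colon M (fun_cont V K)) (colon N (fun_cont V K))
      \<rightarrow>\<^sub>a* Plus (colon (App M V) K) (colon (App N V) K)"
    by (intro alg_steps_plus colon_app)
  then show ?case by (cases "is_value M \<and> is_value N") (auto split: if_splits)
qed auto

text \<open>For a base term in head position, \<open>colon\<close> passes the argument a fixed
  continuation and so is linear in the argument.\<close>

lemma colon_Ar: "rule_Ar M M' \<Longrightarrow> colon M K = colon M' K"
  by (induction rule: rule_Ar.induct) (auto simp: lin_ext_base is_value.intros(2))

lemma colon_step:
  assumes "xi_lin_closure (sup rule_beta_v (sup rule_Al (sup rule_Ar rule_L))) M M'"
  shows "colon M K \<rightarrow>\<^sub>a* colon M' K"
  using assms
proof (induction arbitrary: K)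
  case (1 M M')
  then consider "rule_beta_v M M'" | "rule_Al M M'" | "rule_Ar M M'" | "rule_L M M'"
    by auto
  then show ?case
  proof cases
    case 1
    then show ?thesis by cases (simp only: colon_beta_v)
  next
    case 4
    then have "rule_L (colon M K) (colon M' K)"
      by (rule rule_L_hom [where h = "\<lambda>N. colon N K"]) auto
    then show ?thesis by (blast intro: red_alg_L)
  qed (auto simp: colon_Al colon_Ar)
next
  case (2 M M' N)
  show ?case
  proof (cases "is_value M")
    case True
    then show ?thesis using value_step [OF 2(1)] by simp
  next
    case False
    then have "colon (App M N) K \<rightarrow>\<^sub>a* colon M' (fun_cont N K)"
      using 2(2) by simp
    \<comment> \<open>\<open>M'\<close> may have become a value, which changes the clause of
      \<open>colon\<close> that applies.\<close>
    also have "\<dots> \<rightarrow>\<^sub>a* colon (App M' N) K" by (rule colon_app)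
    finally show ?thesis .
  qed
next
  case (6 V M M')
  \<comment> \<open>The induction hypothesis is used at the continuation
    \<open>arg_cont (Psi B) K\<close> of each base term \<open>B\<close> of \<open>V\<close>; hence
    the generalisation over \<open>K\<close>.\<close>
  then show ?case by (simp add: lin_ext_steps)
qed (auto intro: alg_steps_scale alg_steps_plus)

lemma colon_identity:
  assumes "is_value V"
  shows "colon V (Lam (Var 0)) \<rightarrow>\<^sub>a* Psi V"
proof -
  have "App (Lam (Var 0)) (Psi B) \<rightarrow>\<^sub>a* Psi B" for B :: "'a trm"
    using red_alg_beta [of "Var 0" "Psi B"] by auto
  then have "lin_ext (\<lambda>B. App (Lam (Var 0)) (Psi B)) V \<rightarrow>\<^sub>a* lin_ext Psi V"
    using assms by (intro lin_ext_steps)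
  then show ?thesis using assms by (simp add: colon_value lin_ext_Psi)
qed

theorem theorem6:
  fixes M V :: "'s::{ring,monoid_mult} trm"
  assumes "is_value V" and "red_lin\<^sup>*\<^sup>* M V"
  shows "red_alg\<^sup>*\<^sup>* (App (cps M) (Lam (Var 0))) (Psi V)"
proof -
  have "colon M (Lam (Var 0)) \<rightarrow>\<^sub>a* colon V (Lam (Var 0))"
    using assms(2)
    by (induction rule: rtranclp_induct)
      (auto intro: rtranclp_trans colon_step [OF red_lin_imp_xi_lin_closure])
  then show ?thesis
    using cps_colon colon_identity [OF assms(1)] by (meson rtranclp_trans)
qed

end
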